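(* Let $t$, $d$ and $l$ be positive integers and let $k$ be an integer with $0\le k\le d-1$. The number of $(dt-k)$-core partitions into exactly $l$ parts, each divisible by $d$, is $\binom{l+t-2}{l}$.
   Context: A partition is a finite nonincreasing sequence $\lambda=(\lambda_1,\dots,\lambda_l)$ of positive integers (its parts). The Ferrers diagram of $\lambda$ has $\lambda_j$ nodes in row $j$ (left justified). The hook length of a node is the number of nodes consisting of the node itself, the nodes to its right in the same row and the nodes below it in the same column. For a positive integer $u$, $\lambda$ is a $u$-core partition if no node has hook length $u$ (equivalently, no hook length is divisible by $u$). The binomial coefficient $\binom{n}{m}$ with $n,m\ge0$ is $0$ when $n<m$. *)

theory Defs
  imports Main
begin

definition is_partition :: "nat list \<Rightarrow> bool" where
  "is_partition \<mu> \<longleftrightarrow> sorted_wrt (\<ge>) \<mu> \<and> (\<forall>p\<in>set \<mu>. 0 < p)"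

text \<open>Nodes are pairs (row, column), both counted from 0.\<close>

definition ferrers :: "nat list \<Rightarrow> (nat \<times> nat) set" where
  "ferrers \<mu> = {(i, j). i < length \<mu> \<and> j < \<mu> ! i}"

definition hook :: "nat list \<Rightarrow> nat \<times> nat \<Rightarrow> (nat \<times> nat) set" where
  "hook \<mu> = (\<lambda>(i, j). {(i', j') \<in> ferrers \<mu>. (i' = i \<and> j \<le> j') \<or> (j' = j \<and> i \<le> i')})"

definition hook_length :: "nat list \<Rightarrow> nat \<times> nat \<Rightarrow> nat" where
  "hook_length \<mu> x = card (hook \<mu> x)"

definition is_core :: "nat \<Rightarrow> nat list \<Rightarrow> bool" where
  "is_core u \<mu> \<longleftrightarrow> is_partition \<mu> \<and> (\<forall>x\<in>ferrers \<mu>. hook_length \<mu> x \<noteq> u)"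

end

theory Submission
  imports Defs "HOL-Library.Multiset" "HOL-Library.More_List"
begin

text \<open>
  Pad the partition \<open>\<mu>\<close> with infinitely many zero parts and place a bead at the integer
  \<open>\<mu>\<^sub>i - i\<close> for every row \<open>i \<ge> 0\<close>; these positions strictly decrease with \<open>i\<close>. Row \<open>i\<close> contains a
  node of hook length \<open>u\<close> exactly when the position \<open>\<mu>\<^sub>i - i - u\<close> carries no bead. So \<open>\<mu>\<close> is a
  \<open>u\<close>-core iff for every row \<open>i\<close> there is an \<open>m\<close> with \<open>\<mu>\<^bsub>i+m\<^esub> + u = \<mu>\<^sub>i + m\<close> (\<open>is_core_iff\<close>).

  Now let \<open>u = d t - k\<close> with \<open>0 \<le> k < d\<close> and let \<open>d\<close> divide all parts. Reducing the equation
  modulo \<open>d\<close> gives \<open>m = d c - k\<close> for some \<open>c \<ge> 1\<close>, and the equation becomes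
  \<open>\<mu>\<^sub>i = d (t - c) + \<mu>\<^bsub>i+dc-k\<^esub>\<close>: a part is determined by the later parts and by its code \<open>c\<close>.
  Larger codes give smaller parts, and a new part dominates the previous one exactly when its code
  is at most the previous code. Since the last part is positive, its code is less than \<open>t\<close>. Hence
  the codes of the \<open>l\<close> parts form an arbitrary weakly increasing sequence in \<open>{1..<t}\<close>, and reading
  off the codes is a bijection. Such sequences are multisets of size \<open>l\<close> over a set of \<open>t - 1\<close>
  elements, of which there are \<open>(l + t - 2) choose l\<close>.
\<close>

section \<open>Partitions padded with zero parts\<close>

abbreviation part :: "nat list \<Rightarrow> nat \<Rightarrow> nat" where
  "part \<equiv> nth_default 0"

lemma part_antimono:
  assumes "is_partition \<mu>" "i \<le> j"
  shows "part \<mu> j \<le> part \<mu> i"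
  using assms
  by (cases "i = j") (auto simp: nth_default_def is_partition_def sorted_wrt_iff_nth_less)

lemma dvd_part: "\<forall>p\<in>set \<mu>. d dvd p \<Longrightarrow> d dvd part \<mu> i"
  unfolding nth_default_def by (metis dvd_0_right nth_mem)

lemma is_partition_Cons:
  "is_partition (a # \<mu>) \<longleftrightarrow> is_partition \<mu> \<and> 0 < a \<and> part \<mu> 0 \<le> a"
proof (cases \<mu>)
  case Nil
  then show ?thesis by (simp add: is_partition_def)
next
  case (Cons b \<nu>)
  then show ?thesis by (fastforce simp: is_partition_def)
qed

section \<open>Cores in terms of bead positions\<close>

text \<open>The bounds on \<open>j\<close> say that column \<open>j\<close> ends in row \<open>i + m\<close>, so the leg of the node
  \<open>(i, j)\<close> has \<open>m\<close> nodes.\<close>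

lemma hook_length_eq_arm_leg:
  assumes part: "is_partition \<mu>"
    and leg: "j < part \<mu> (i + m)" "part \<mu> (Suc (i + m)) \<le> j"
  shows "hook_length \<mu> (i, j) = part \<mu> i - j + m"
proof -
  have len: "i + m < length \<mu>"
    using leg(1) by (auto simp: nth_default_def split: if_splits)
  have below: "i' < length \<mu> \<and> j < \<mu> ! i' \<longleftrightarrow> i' \<le> i + m" for i'
  proof (cases "i' \<le> i + m")
    case True
    then show ?thesis
      using part_antimono[OF part True] leg(1) len by (simp add: nth_default_def)
  next
    case False
    then have "part \<mu> i' \<le> j"
      using part_antimono[OF part, of "Suc (i + m)" i'] leg(2) by simp
    then show ?thesis
      using False by (auto simp: nth_default_def)
  qed
  have "hook \<mu> (i, j) = {i} \<times> {j..<part \<mu> i} \<union> {i<..i + m} \<times> {j}"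
  proof (rule set_eqI)
    fix x :: "nat \<times> nat"
    obtain i' j' where x: "x = (i', j')" by (rule prod.exhaust)
    have "x \<in> hook \<mu> (i, j) \<longleftrightarrow> i' < length \<mu> \<and> j' < \<mu> ! i' \<and>
        (i' = i \<and> j \<le> j' \<or> j' = j \<and> i \<le> i')"
      by (simp add: x hook_def ferrers_def)
    also have "\<dots> \<longleftrightarrow> i' = i \<and> j \<le> j' \<and> j' < \<mu> ! i \<or> j' = j \<and> i < i' \<and> i' \<le> i + m"
      using below[of i'] below[of i] len by (cases "i' = i") auto
    finally show "x \<in> hook \<mu> (i, j) \<longleftrightarrow>
        x \<in> {i} \<times> {j..<part \<mu> i} \<union> {i<..i + m} \<times> {j}"
      using len by (auto simp: x nth_default_def)
  qed
  moreover have "card ({i} \<times> {j..<part \<mu> i} \<union> {i<..i + m} \<times> {j})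
      = card ({i} \<times> {j..<part \<mu> i}) + card ({i<..i + m} \<times> {j})"
    by (rule card_Un_disjoint) auto
  ultimately show ?thesis
    by (simp add: hook_length_def)
qed

text \<open>
  The positions \<open>\<mu>\<^sub>n - n\<close> strictly decrease, so either one of them equals \<open>\<mu>\<^sub>i - i - u\<close>, or this
  integer falls strictly between the positions of two consecutive rows \<open>i + m\<close> and \<open>i + m + 1\<close>.
  In the latter case column \<open>j = \<mu>\<^sub>i + m - u\<close> ends in row \<open>i + m\<close>, and the node \<open>(i, j)\<close> has hook
  length \<open>\<mu>\<^sub>i - j + m = u\<close>. Conversely, a node of hook length \<open>u\<close> puts \<open>\<mu>\<^sub>i - i - u\<close> into such
  a gap.
\<close>

lemma ex_hook_length_in_row_iff:
  assumes part: "is_partition \<mu>" and u: "0 < u"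
  shows "(\<exists>j. (i, j) \<in> ferrers \<mu> \<and> hook_length \<mu> (i, j) = u)
    \<longleftrightarrow> \<not> (\<exists>m. part \<mu> (i + m) + u = part \<mu> i + m)"
    (is "?hook \<longleftrightarrow> \<not> ?move")
proof
  assume ?hook
  then obtain j where j: "j < part \<mu> i" and u_eq: "hook_length \<mu> (i, j) = u"
    by (auto simp: ferrers_def nth_default_def)
  \<comment> \<open>\<open>i + n\<close> is the first row, from \<open>i\<close> on, that does not reach column \<open>j\<close>.\<close>
  define n where "n = (LEAST n. part \<mu> (i + n) \<le> j)"
  have ex: "part \<mu> (i + length \<mu>) \<le> j"
    by (simp add: nth_default_def)
  have n: "part \<mu> (i + n) \<le> j"
    unfolding n_def using ex by (rule LeastI)
  then obtain m where m: "n = Suc m"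
    using j by (cases n) auto
  have leg: "j < part \<mu> (i + m)"
    using not_less_Least[of m "\<lambda>n. part \<mu> (i + n) \<le> j"] m unfolding n_def by simp
  have u_val: "u = part \<mu> i - j + m"
    using hook_length_eq_arm_leg[OF part leg] n m u_eq by simp
  show "\<not> ?move"
  proof
    assume ?move
    then obtain q where q: "part \<mu> (i + q) + u = part \<mu> i + q" by blast
    show False
    proof (cases "q \<le> m")
      case True
      then show False
        using part_antimono[OF part, of "i + q" "i + m"] leg q u_val j by simp
    next
      case False
      then show False
        using part_antimono[OF part, of "i + n" "i + q"] n m q u_val j by simp
    qed
  qed
next
  assume no_move: "\<not> ?move"
  \<comment> \<open>\<open>i + n\<close> is the first row whose bead lies at or below \<open>\<mu>\<^sub>i - i - u\<close>.\<close>
  define n where "n = (LEAST n. part \<mu> (i + n) + u \<le> part \<mu> i + n)"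
  have ex: "part \<mu> (i + (length \<mu> + u)) + u \<le> part \<mu> i + (length \<mu> + u)"
    by (simp add: nth_default_def)
  have n: "part \<mu> (i + n) + u \<le> part \<mu> i + n"
    unfolding n_def using ex by (rule LeastI)
  then obtain m where m: "n = Suc m"
    using u by (cases n) auto
  have above: "part \<mu> i + m < part \<mu> (i + m) + u"
    using not_less_Least[of m "\<lambda>n. part \<mu> (i + n) + u \<le> part \<mu> i + n"] m
    unfolding n_def by simp
  have below: "part \<mu> (i + n) + u < part \<mu> i + n"
    using n no_move by (meson le_neq_implies_less)
  define j where "j = part \<mu> i + m - u"
  have j: "j + u = part \<mu> i + m"
    using below m by (simp add: j_def)
  have leg: "j < part \<mu> (i + m)" "part \<mu> (Suc (i + m)) \<le> j"
    using above below m j by simp_all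
  have arm: "j < part \<mu> i"
    using leg(1) part_antimono[OF part, of i "i + m"] by simp
  have "hook_length \<mu> (i, j) = u"
    using hook_length_eq_arm_leg[OF part leg] j arm by simp
  moreover have "(i, j) \<in> ferrers \<mu>"
    using arm by (auto simp: ferrers_def nth_default_def split: if_splits)
  ultimately show ?hook by blast
qed

lemma is_core_iff:
  assumes "0 < u"
  shows "is_core u \<mu> \<longleftrightarrow> is_partition \<mu> \<and>
    (\<forall>i<length \<mu>. \<exists>m. part \<mu> (i + m) + u = part \<mu> i + m)"
proof -
  have "(\<forall>x\<in>ferrers \<mu>. hook_length \<mu> x \<noteq> u) \<longleftrightarrow>
      (\<forall>i<length \<mu>. \<not> (\<exists>j. (i, j) \<in> ferrers \<mu> \<and> hook_length \<mu> (i, j) = u))"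
    unfolding Ball_def split_paired_All by (auto simp: ferrers_def)
  then show ?thesis
    unfolding is_core_def using ex_hook_length_in_row_iff[OF _ assms] by blast
qed

text \<open>Whether row \<open>i\<close> has a hook of length \<open>u\<close> depends only on the rows from \<open>i\<close> on, so cores can
  be built up by repeatedly putting a new largest part in front.\<close>

lemma is_core_Cons:
  assumes "0 < u"
  shows "is_core u (a # \<mu>) \<longleftrightarrow> is_core u \<mu> \<and> 0 < a \<and> part \<mu> 0 \<le> a \<and>
    (\<exists>m. part (a # \<mu>) m + u = a + m)"
  unfolding is_core_iff[OF assms] is_partition_Cons
  by (auto simp: All_less_Suc2)

section \<open>Codes of cores whose parts are divisible by \<open>d\<close>\<close>

text \<open>
  A code \<open>c\<close> makes \<open>m = d c - k\<close> solve the core equation of the row it creates. This \<open>m\<close> counts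
  from the new first part, which shifts the index into the remaining parts by one. For
  \<open>k < d\<close> and \<open>1 \<le> c\<close> no subtraction in \<open>d c - k - 1\<close> is truncated.
\<close>

fun decode :: "nat \<Rightarrow> nat \<Rightarrow> nat \<Rightarrow> nat list \<Rightarrow> nat list" where
  "decode t d k [] = []"
| "decode t d k (c # cs) =
    (d * (t - c) + part (decode t d k cs) (d * c - k - 1)) # decode t d k cs"

lemma length_decode [simp]: "length (decode t d k cs) = length cs"
  by (induction cs) auto

lemma dvd_decode: "\<forall>p\<in>set (decode t d k cs). d dvd p"
  by (induction cs) (simp_all add: dvd_part)

text \<open>Different codes create different parts on top of the same partition, which makes decoding
  injective.\<close>

lemma new_part_strict_antimono:
  assumes "is_partition \<mu>" "0 < d" "c < c'" "c' \<le> t"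
  shows "d * (t - c') + part \<mu> (d * c' - k - 1) < d * (t - c) + part \<mu> (d * c - k - 1)"
proof -
  have "d * (t - c') < d * (t - c)"
    using assms by simp
  moreover have "d * c - k - 1 \<le> d * c' - k - 1"
    using assms by (intro diff_le_mono mult_le_mono) auto
  ultimately show ?thesis
    using part_antimono[OF assms(1)] by (meson add_less_le_mono)
qed

text \<open>
  Weakly increasing codes correspond to weakly decreasing parts. The head \<open>b\<close> with code \<open>c'\<close> is
  \<open>d (t - c')\<close> plus the part of \<open>b # \<mu>\<close> at index \<open>d c' - k\<close>, whereas the new part uses index
  \<open>d c - k - 1\<close> of the same list. For \<open>c \<le> c'\<close> the latter index is smaller. For \<open>c > c'\<close> it is at
  least \<open>d c' - k\<close>, because \<open>d \<ge> 1\<close> absorbs the shift by one, and the term \<open>d (t - c)\<close> is strictly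
  smaller than \<open>d (t - c')\<close>.
\<close>

lemma new_part_ge_head_iff:
  assumes part: "is_partition (b # \<mu>)" and k: "k < d"
    and c: "1 \<le> c" "c \<le> t" and c': "1 \<le> c'" "c' \<le> t"
    and b: "b = d * (t - c') + part \<mu> (d * c' - k - 1)"
  shows "b \<le> d * (t - c) + part (b # \<mu>) (d * c - k - 1) \<longleftrightarrow> c \<le> c'"
proof -
  have pos: "d \<le> d * c'" using c' by simp
  have "d * c' - k = Suc (d * c' - k - 1)"
    using pos k by linarith
  then have b': "b = d * (t - c') + part (b # \<mu>) (d * c' - k)"
    using b by (metis nth_default_Cons_Suc)
  show ?thesis
  proof (cases "c \<le> c'")
    case True
    then have "d * (t - c') \<le> d * (t - c)" "d * c - k - 1 \<le> d * c' - k"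
      by (meson diff_le_mono diff_le_mono2 diff_le_self le_trans mult_le_mono2)+
    then show ?thesis
      using True part_antimono[OF part] b' by (metis add_mono)
  next
    case False
    then have "d * c' + d \<le> d * c"
      by (metis Suc_leI add.commute linorder_not_le mult_Suc_right mult_le_mono2)
    then have "d * c' - k \<le> d * c - k - 1"
      using k by linarith
    then have "part (b # \<mu>) (d * c - k - 1) \<le> part (b # \<mu>) (d * c' - k)"
      by (rule part_antimono[OF part])
    moreover have "d * (t - c) < d * (t - c')"
      using False c k by simp
    ultimately show ?thesis
      using False b' by linarith
  qed
qed

text \<open>The core equation holds by the choice of each part; that the parts decrease follows from the
  order of the codes.\<close>

lemma is_core_decode:
  assumes k: "k < d" and t: "0 < t"
    and cs: "sorted cs" "set cs \<subseteq> {1..<t}"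
  shows "is_core (d * t - k) (decode t d k cs)"
  using cs
proof (induction cs)
  case Nil
  then show ?case by (simp add: is_core_def is_partition_def ferrers_def)
next
  case (Cons c cs)
  define \<mu> where "\<mu> = decode t d k cs"
  define a where "a = d * (t - c) + part \<mu> (d * c - k - 1)"
  have c: "1 \<le> c" "c < t" using Cons.prems by auto
  have core: "is_core (d * t - k) \<mu>"
    using Cons by (simp add: \<mu>_def)
  then have partition: "is_partition \<mu>" by (simp add: is_core_def)
  have "d \<le> d * t" "d \<le> d * c" using t c by auto
  then have u: "0 < d * t - k" and ge: "k < d * c" using k by linarith+
  have le: "d * c \<le> d * t" using c by simp
  have "0 < a"
    using c k by (simp add: a_def)
  moreover have "part \<mu> 0 \<le> a"
  proof (cases cs)
    case Nil
    then show ?thesis by (simp add: \<mu>_def)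
  next
    case (Cons c' cs')
    define \<nu> where "\<nu> = decode t d k cs'"
    define b where "b = d * (t - c') + part \<nu> (d * c' - k - 1)"
    have \<mu>: "\<mu> = b # \<nu>"
      by (simp add: \<mu>_def \<nu>_def b_def Cons)
    have "c \<le> c'" "1 \<le> c'" "c' \<le> t"
      using Cons.prems Cons by auto
    then have "b \<le> a"
      using new_part_ge_head_iff[OF _ k c(1) _ _ _ b_def] partition c
      unfolding a_def \<mu> by simp
    then show ?thesis by (simp add: \<mu>)
  qed
  moreover have "part (a # \<mu>) (d * c - k) + (d * t - k) = a + (d * c - k)"
  proof -
    have "part (a # \<mu>) (d * c - k) = part \<mu> (d * c - k - 1)"
      using ge by (metis Suc_pred' nth_default_Cons_Suc zero_less_diff)
    moreover have "a + d * c = d * t + part \<mu> (d * c - k - 1)"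
      unfolding a_def diff_mult_distrib2 using le by linarith
    ultimately show ?thesis
      using ge le by linarith
  qed
  ultimately have "is_core (d * t - k) (a # \<mu>)"
    using is_core_Cons[OF u] core by blast
  then show ?case by (simp add: a_def \<mu>_def)
qed

text \<open>
  The code of the first part \<open>a\<close> comes from the core equation of the first row, reduced modulo
  \<open>d\<close>. That equation only gives \<open>1 \<le> c \<le> t\<close>; the value \<open>c = t\<close> is ruled out by \<open>a > 0\<close> if there
  are no further parts, and by \<open>c \<le> c' < t\<close> for the code \<open>c'\<close> of the next part otherwise.
\<close>

lemma ex_decode:
  assumes k: "k < d" and t: "0 < t"
    and core: "is_core (d * t - k) \<mu>" and dvd: "\<forall>p\<in>set \<mu>. d dvd p"
  shows "\<exists>cs. sorted cs \<and> set cs \<subseteq> {1..<t} \<and> decode t d k cs = \<mu>"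
  using core dvd
proof (induction \<mu>)
  case Nil
  show ?case by (rule exI[of _ "[]"]) simp
next
  case (Cons a \<mu>)
  have "d \<le> d * t" using t by simp
  then have u: "0 < d * t - k" and k_le: "k \<le> d * t" using k by linarith+
  have core: "is_core (d * t - k) \<mu>" and pos: "0 < a" and head: "part \<mu> 0 \<le> a"
    using Cons.prems(1) is_core_Cons[OF u] by blast+
  obtain m where m: "part (a # \<mu>) m + (d * t - k) = a + m"
    using Cons.prems(1) is_core_Cons[OF u] by blast
  obtain cs where cs: "sorted cs" "set cs \<subseteq> {1..<t}" and \<mu>: "decode t d k cs = \<mu>"
    using Cons core by auto
  have partition: "is_partition (a # \<mu>)" "is_partition \<mu>"
    using Cons.prems(1) core by (simp_all add: is_core_def)
  have "m \<noteq> 0" using m u by (cases m) auto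
  have sum: "part (a # \<mu>) m + d * t = a + (m + k)"
    using m k_le by linarith
  then have "d dvd a + (m + k)"
    using dvd_part[OF Cons.prems(2), of m] by (metis dvd_add dvd_triv_left)
  then have "d dvd m + k"
    using Cons.prems(2) by (simp add: dvd_add_right_iff)
  then obtain c where c: "m + k = d * c" ..
  have "c \<noteq> 0" using c \<open>m \<noteq> 0\<close> by (cases c) auto
  have "part (a # \<mu>) m \<le> a"
    using part_antimono[OF partition(1), of 0 m] by simp
  then have "d * c \<le> d * t" using sum c by linarith
  then have "c \<le> t" using k by simp
  have m_eq: "m = Suc (d * c - k - 1)" using c \<open>m \<noteq> 0\<close> by linarith
  have "a = d * (t - c) + part (a # \<mu>) m"
    using sum c \<open>d * c \<le> d * t\<close> by (simp add: diff_mult_distrib2)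
  then have a: "a = d * (t - c) + part \<mu> (d * c - k - 1)"
    using m_eq by (metis nth_default_Cons_Suc)
  have "c < t \<and> sorted (c # cs)"
  proof (cases cs)
    case Nil
    then have "\<mu> = []" using \<mu> by simp
    then have "0 < d * (t - c)" using a pos by simp
    then show ?thesis using Nil by simp
  next
    case (Cons c' cs')
    define \<nu> where "\<nu> = decode t d k cs'"
    define b where "b = d * (t - c') + part \<nu> (d * c' - k - 1)"
    have \<mu>': "\<mu> = b # \<nu>"
      using \<mu> by (simp add: \<nu>_def b_def Cons)
    have c': "1 \<le> c'" "c' < t"
      using cs Cons by auto
    have "c \<le> c'"
      using new_part_ge_head_iff[OF _ k _ _ _ _ b_def, of c] partition head a c'
        \<open>c \<noteq> 0\<close> \<open>c \<le> t\<close> unfolding \<mu>' by simp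
    then show ?thesis
      using c' cs(1) Cons by auto
  qed
  then have "sorted (c # cs) \<and> set (c # cs) \<subseteq> {1..<t} \<and> decode t d k (c # cs) = a # \<mu>"
    using cs a \<mu> \<open>c \<noteq> 0\<close> by simp
  then show ?case by blast
qed

lemma decode_inject:
  assumes k: "k < d" and t: "0 < t"
    and "sorted cs" "set cs \<subseteq> {1..<t}" "sorted cs'" "set cs' \<subseteq> {1..<t}"
    and "decode t d k cs = decode t d k cs'"
  shows "cs = cs'"
  using assms(3-)
proof (induction cs arbitrary: cs')
  case Nil
  then show ?case by (cases cs') auto
next
  case (Cons c cs)
  then obtain c' es where cs': "cs' = c' # es" by (cases cs') auto
  have "cs = es" using Cons cs' by auto
  have "is_partition (decode t d k cs)"
    using is_core_decode[OF k t, of cs] Cons.prems by (simp add: is_core_def)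
  then have "c = c'"
    using new_part_strict_antimono[of "decode t d k cs" d c c' t k]
      new_part_strict_antimono[of "decode t d k cs" d c' c t k]
      Cons.prems cs' \<open>cs = es\<close> k by (cases c c' rule: linorder_cases) auto
  then show ?case using cs' \<open>cs = es\<close> by simp
qed

section \<open>Counting codes\<close>

lemma bij_betw_sorted_lists_multisets:
  fixes A :: "'a :: linorder set"
  shows "bij_betw mset {xs. sorted xs \<and> set xs \<subseteq> A \<and> length xs = n} (multisets_of_size A n)"
  by (rule bij_betw_byWitness[where f' = sorted_list_of_multiset])
    (auto simp: multisets_of_size_def sorted_sort_id simp flip: size_mset)

lemma
  fixes A :: "'a :: linorder set"
  assumes "finite A"
  shows finite_sorted_lists: "finite {xs. sorted xs \<and> set xs \<subseteq> A \<and> length xs = n}"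
    and card_sorted_lists: "card {xs. sorted xs \<and> set xs \<subseteq> A \<and> length xs = n} =
      (card A + n - 1) choose n"
  using bij_betw_finite[OF bij_betw_sorted_lists_multisets, of A n]
    bij_betw_same_card[OF bij_betw_sorted_lists_multisets, of A n]
    finite_multisets_of_size[OF assms, of n] card_multisets_of_size[OF assms, of n]
  by simp_all

section \<open>The number of cores\<close>

theorem corollary2p10:
  fixes t d l k :: nat
  assumes "0 < t" and "0 < d" and "0 < l" and "k \<le> d - 1"
  shows "finite {\<mu>. is_core (d * t - k) \<mu> \<and> length \<mu> = l \<and> (\<forall>p\<in>set \<mu>. d dvd p)} \<and>
    card {\<mu>. is_core (d * t - k) \<mu> \<and> length \<mu> = l \<and> (\<forall>p\<in>set \<mu>. d dvd p)} = (l + t - 2) choose l"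
proof -
  have k: "k < d" using assms by simp
  let ?cores = "{\<mu>. is_core (d * t - k) \<mu> \<and> length \<mu> = l \<and> (\<forall>p\<in>set \<mu>. d dvd p)}"
  let ?codes = "{cs. sorted cs \<and> set cs \<subseteq> {1..<t} \<and> length cs = l}"
  have "bij_betw (decode t d k) ?codes ?cores"
    unfolding bij_betw_def
  proof
    show "inj_on (decode t d k) ?codes"
      by (rule inj_onI) (use decode_inject[OF k assms(1)] in blast)
    show "decode t d k ` ?codes = ?cores"
    proof (intro subset_antisym subsetI)
      fix \<mu> assume "\<mu> \<in> decode t d k ` ?codes"
      then show "\<mu> \<in> ?cores"
        using is_core_decode[OF k assms(1)] dvd_decode by auto
    next
      fix \<mu> assume "\<mu> \<in> ?cores"
      then obtain cs where "sorted cs" "set cs \<subseteq> {1..<t}" "decode t d k cs = \<mu>" "length \<mu> = l"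
        using ex_decode[OF k assms(1)] by blast
      then show "\<mu> \<in> decode t d k ` ?codes" by force
    qed
  qed
  then have cores: "finite ?codes \<longleftrightarrow> finite ?cores" "card ?codes = card ?cores"
    by (rule bij_betw_finite, rule bij_betw_same_card)
  have "finite ?codes" "card ?codes = (t - 1 + l - 1) choose l"
    using finite_sorted_lists[of "{1..<t}" l] card_sorted_lists[of "{1..<t}" l] by simp_all
  moreover have "t - 1 + l - 1 = l + t - 2"
    using assms by simp
  ultimately show ?thesis
    using cores by simp
qed

end
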